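(* Let $(X,d)$ be a finite ultrametric space with $|X|\ge 2$. Then the following statements are equivalent: (i) $X\in\mathfrak{R}$; (ii) the inequality $|E(G_Y)|\le|E(G_Z)|$ holds for all $Y\subseteq X$ and all ultrametric spaces $Z$ which satisfy the condition $|Y|=|Z|\ge2$.
   Context: An ultrametric space is a metric space with $d(x,y)\le\max\{d(x,z),d(z,y)\}$ for all $x,y,z$. $\operatorname{Iso}(X)$ is the group of isometries of $(X,d)$ (bijective distance-preserving maps $X\to X$), and $\operatorname{Fix}(g)=\{x\in X: g(x)=x\}$. $\mathfrak{R}$ denotes the class of all finite ultrametric spaces $(X,d)$ with $\min_{g\in \operatorname{Iso}(X)}|\operatorname{Fix}(g)|=|X|-2$. For a finite ultrametric space $W$ with $|W|\ge2$, the diametrical graph $G_W$ has vertex set $W$, and $u,v$ are adjacent iff their distance equals $\operatorname{diam}W$. $E(\cdot)$ is the set of edges. A subset $Y\subseteq X$ carries the restricted metric. *)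

theory Defs
  imports "HOL-Analysis.Analysis" "HOL-Library.Infinite_Typeclass"
begin

locale ultrametric_space = Metric_space +
  assumes ultra: "\<lbrakk>x \<in> M; y \<in> M; z \<in> M\<rbrakk> \<Longrightarrow> d x y \<le> max (d x z) (d z y)"

text \<open>Isometries are taken to be \<^const>\<open>extensional\<close>, so that each self-map of the
  carrier is represented by exactly one HOL function.\<close>

definition Iso :: "'a set \<Rightarrow> ('a \<Rightarrow> 'a \<Rightarrow> real) \<Rightarrow> ('a \<Rightarrow> 'a) set" where
  "Iso X d = {g \<in> extensional X. bij_betw g X X \<and> (\<forall>x\<in>X. \<forall>y\<in>X. d (g x) (g y) = d x y)}"

definition Fix :: "'a set \<Rightarrow> ('a \<Rightarrow> 'a) \<Rightarrow> 'a set" where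
  "Fix X g = {x \<in> X. g x = x}"

definition class_R :: "'a set \<Rightarrow> ('a \<Rightarrow> 'a \<Rightarrow> real) \<Rightarrow> bool" where
  "class_R X d \<longleftrightarrow> finite X \<and> ultrametric_space X d \<and>
     int (Min ((\<lambda>g. card (Fix X g)) ` Iso X d)) = int (card X) - 2"

definition diam :: "'a set \<Rightarrow> ('a \<Rightarrow> 'a \<Rightarrow> real) \<Rightarrow> real" where
  "diam W d = (SUP (x,y)\<in>W \<times> W. d x y)"

text \<open>A simple graph is a pair of a vertex set and a set of two-element edges. The clause
  \<^prop>\<open>u \<noteq> v\<close> is automatic for a finite \<^term>\<open>W\<close> with at least two points, where the
  diameter is positive.\<close>

definition diametrical_graph :: "'a set \<Rightarrow> ('a \<Rightarrow> 'a \<Rightarrow> real) \<Rightarrow> 'a set \<times> 'a set set" where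
  "diametrical_graph W d = (W, {{u, v} | u v. u \<in> W \<and> v \<in> W \<and> u \<noteq> v \<and> d u v = diam W d})"

definition edges :: "'a set \<times> 'a set set \<Rightarrow> 'a set set" where
  "edges G = snd G"

text \<open>A subset \<^term>\<open>Y\<close> of \<^term>\<open>X\<close> carries the restricted metric simply by pairing
  \<^term>\<open>Y\<close> with the same distance function. A statement about all finite spaces is made
  by quantifying over all carriers inside an arbitrary type of class \<^class>\<open>infinite\<close>:
  such a type contains an isometric copy of every finite space.\<close>

end

theory Submission
  imports Defs
begin

text \<open>The diametrical graph of a space with \<open>n\<close> points is complete multipartite with at least
  two parts, so it has at least \<open>n - 1\<close> edges, with equality exactly for stars. Hence (ii) says
  that every \<open>G\<^sub>Y\<close> is a star, which fails precisely when \<open>X\<close> contains an equilateral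
  triangle or two pairs of points that are each closer together than they are to one another.
  Swapping a closest pair is an isometry of \<open>X\<close>, also when the pair is taken closest in a
  subset whose points are indistinguishable from outside; so (i) says that no isometry moves
  more than two points, and a forbidden configuration produces two such swaps, whose composition
  moves at least three points. Conversely, the points moved by an isometry that moves more than
  two points contain a forbidden configuration.\<close>

section \<open>Forbidden configurations, twins and homogeneous sets\<close>

text \<open>In a metric space \<open>a \<noteq> b\<close> makes the common side in the first clause
  positive, so genuine equilateral triangles are excluded. The second clause excludes pairs
  \<open>{a, b}\<close> and \<open>{c, e}\<close> that are both shorter than \<open>d a c\<close>;
  in an ultrametric space all four cross distances then equal \<open>d a c\<close>.\<close>

definition stellar :: "'a set \<Rightarrow> ('a \<Rightarrow> 'a \<Rightarrow> real) \<Rightarrow> bool" where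
  "stellar X d \<longleftrightarrow>
     (\<forall>a\<in>X. \<forall>b\<in>X. \<forall>c\<in>X. a \<noteq> b \<longrightarrow> d a b = d b c \<longrightarrow> d a b \<noteq> d a c) \<and>
     (\<forall>a\<in>X. \<forall>b\<in>X. \<forall>c\<in>X. \<forall>e\<in>X. a \<noteq> b \<longrightarrow> c \<noteq> e \<longrightarrow> d a b < d a c \<longrightarrow> d a c \<le> d c e)"

text \<open>In a metric space these are exactly the pairs whose transposition preserves all
  distances.\<close>

definition twins :: "'a set \<Rightarrow> ('a \<Rightarrow> 'a \<Rightarrow> real) \<Rightarrow> 'a \<Rightarrow> 'a \<Rightarrow> bool" where
  "twins X d x y \<longleftrightarrow> x \<in> X \<and> y \<in> X \<and> x \<noteq> y \<and> (\<forall>z\<in>X - {x, y}. d x z = d y z)"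

text \<open>A module in the graph-theoretic sense, with distances in place of adjacency; the
  two-element modules are the pairs of twins.\<close>

definition homogeneous_in :: "'a set \<Rightarrow> ('a \<Rightarrow> 'a \<Rightarrow> real) \<Rightarrow> 'a set \<Rightarrow> bool" where
  "homogeneous_in X d S \<longleftrightarrow> S \<subseteq> X \<and> (\<forall>x\<in>S. \<forall>y\<in>S. \<forall>z\<in>X - S. d x z = d y z)"

section \<open>Edges and diameter\<close>

lemma edges_diametrical_graph:
  "edges (diametrical_graph W d) = {{u, v} | u v. u \<in> W \<and> v \<in> W \<and> u \<noteq> v \<and> d u v = diam W d}"
  by (simp add: edges_def diametrical_graph_def)

lemma finite_edges_diametrical_graph:
  assumes "finite W"
  shows "finite (edges (diametrical_graph W d))"
  by (rule finite_subset[of _ "Pow W"]) (auto simp: edges_diametrical_graph assms)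

lemma edge_diametrical_graphI:
  assumes "u \<in> W" "v \<in> W" "u \<noteq> v" "d u v = diam W d"
  shows "{u, v} \<in> edges (diametrical_graph W d)"
  using assms by (auto simp: edges_diametrical_graph)

lemma diam_eqI:
  assumes "u \<in> W" "v \<in> W" "d u v = D" "\<And>x y. \<lbrakk>x \<in> W; y \<in> W\<rbrakk> \<Longrightarrow> d x y \<le> D"
  shows "diam W d = D"
  unfolding diam_def
proof (rule cSup_eq_maximum)
  show "D \<in> (\<lambda>(x, y). d x y) ` (W \<times> W)"
    using assms(1-3) by force
qed (use assms(4) in auto)

lemma diam_attained:
  assumes "finite W" "W \<noteq> {}"
  obtains u v where "u \<in> W" "v \<in> W" "d u v = diam W d"
    "\<And>x y. \<lbrakk>x \<in> W; y \<in> W\<rbrakk> \<Longrightarrow> d x y \<le> diam W d"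
proof -
  let ?S = "(\<lambda>(x, y). d x y) ` (W \<times> W)"
  have S: "finite ?S" "?S \<noteq> {}"
    using assms by auto
  then have D: "diam W d = Max ?S"
    unfolding diam_def by (simp add: cSup_eq_Max)
  obtain u v where "u \<in> W" "v \<in> W" "d u v = Max ?S"
    using Max_in[OF S] by auto
  moreover have "d x y \<le> Max ?S" if "x \<in> W" "y \<in> W" for x y
    using S that by (intro Max_ge) auto
  ultimately show thesis
    using that D by metis
qed

section \<open>Isometries and fixed points\<close>

lemma finite_Iso:
  assumes "finite X"
  shows "finite (Iso X d)"
proof (rule finite_subset)
  show "Iso X d \<subseteq> X \<rightarrow>\<^sub>E X"
    by (auto simp: Iso_def PiE_def bij_betw_def)
  show "finite (X \<rightarrow>\<^sub>E X)"
    using assms by (simp add: finite_PiE)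
qed

lemma compose_Iso:
  assumes "f \<in> Iso X d" "g \<in> Iso X d"
  shows "compose X f g \<in> Iso X d"
proof -
  have "g x \<in> X" if "x \<in> X" for x
    using assms(2) that by (auto simp: Iso_def bij_betw_def)
  then show ?thesis
    using assms by (auto simp: Iso_def compose_eq intro: bij_betw_compose)
qed

lemma card_Fix:
  assumes "finite X"
  shows "card (Fix X g) + card {x \<in> X. g x \<noteq> x} = card X"
proof -
  have "Fix X g \<union> {x \<in> X. g x \<noteq> x} = X" "Fix X g \<inter> {x \<in> X. g x \<noteq> x} = {}"
    by (auto simp: Fix_def)
  then show ?thesis
    using assms card_Un_disjoint[of "Fix X g" "{x \<in> X. g x \<noteq> x}"] by (simp add: Fix_def)
qed

section \<open>Counting diametrical edges\<close>

context ultrametric_space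
begin

lemma subspace_ultrametric:
  assumes "W \<subseteq> M"
  shows "ultrametric_space W d"
proof -
  interpret W: Metric_space W d
    using assms by (rule subspace)
  show ?thesis
    by unfold_locales (use assms ultra in blast)
qed

lemma isosceles:
  assumes "x \<in> M" "y \<in> M" "z \<in> M" "d x y < d y z"
  shows "d x z = d y z"
  using ultra[of x z y] ultra[of y z x] assms commute[of x y] by auto

lemma diam_positive:
  assumes "finite M" "card M \<ge> 2"
  obtains u v where "u \<in> M" "v \<in> M" "u \<noteq> v" "d u v = diam M d"
    "\<And>x y. \<lbrakk>x \<in> M; y \<in> M\<rbrakk> \<Longrightarrow> d x y \<le> diam M d"
proof -
  have "M \<noteq> {}"
    using assms by auto
  then obtain u v where uv: "u \<in> M" "v \<in> M" "d u v = diam M d"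
    and le: "\<And>x y. \<lbrakk>x \<in> M; y \<in> M\<rbrakk> \<Longrightarrow> d x y \<le> diam M d"
    using diam_attained assms(1) by metis
  obtain a b where "a \<in> M" "b \<in> M" "a \<noteq> b"
    using assms(2) card_le_Suc0_iff_eq[OF assms(1)] by (metis not_less_eq_eq numeral_2_eq_2)
  then have "diam M d > 0"
    using le[of a b] mdist_pos_less[of a b] by linarith
  then have "u \<noteq> v"
    using uv by auto
  then show thesis
    using that uv le by metis
qed

text \<open>Every point is adjacent to at least one end of a fixed diametrical edge \<open>{u, v}\<close>; this
  selects a spanning tree.\<close>

lemma card_edges_ge:
  assumes "finite M" "card M \<ge> 2"
  shows "card M - 1 \<le> card (edges (diametrical_graph M d))"
proof -
  obtain u v where uv: "u \<in> M" "v \<in> M" "u \<noteq> v" "d u v = diam M d"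
    and le: "\<And>x y. \<lbrakk>x \<in> M; y \<in> M\<rbrakk> \<Longrightarrow> d x y \<le> diam M d"
    using diam_positive assms by metis
  define a where "a z = (if d z u = diam M d then u else v)" for z
  have av: "a v = u"
    using uv commute by (simp add: a_def)
  have pos: "0 < diam M d"
    using uv mdist_pos_less[of u v] by simp
  have da: "d z (a z) = diam M d" if "z \<in> M" for z
    using le[of z u] le[of z v] ultra[of u v z] uv that commute[of u z] by (auto simp: a_def)
  have aM: "a z \<in> M" for z
    using uv by (simp add: a_def)
  \<comment> \<open>Two distinct points with the same edge would have chosen each other. With the
    root \<open>u\<close> left out, both would have to be \<open>v\<close>.\<close>
  have "inj_on (\<lambda>z. {z, a z}) (M - {u})"
  proof (rule inj_onI)
    fix x y
    assume xy: "x \<in> M - {u}" "y \<in> M - {u}" "{x, a x} = {y, a y}"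
    show "x = y"
    proof (rule ccontr)
      assume "x \<noteq> y"
      then have "x = a y" "y = a x"
        using xy(3) by (auto simp: doubleton_eq_iff)
      then have "x = v" "y = v"
        using xy by (auto simp: a_def split: if_splits)
      then show False
        using \<open>x \<noteq> y\<close> by simp
    qed
  qed
  moreover have "(\<lambda>z. {z, a z}) ` (M - {u}) \<subseteq> edges (diametrical_graph M d)"
  proof (rule image_subsetI)
    fix z
    assume "z \<in> M - {u}"
    then have "z \<in> M"
      by simp
    moreover have "z \<noteq> a z"
      using da[OF \<open>z \<in> M\<close>] pos mdist_zero[OF \<open>z \<in> M\<close>] by (metis less_irrefl)
    ultimately show "{z, a z} \<in> edges (diametrical_graph M d)"
      using da aM by (intro edge_diametrical_graphI) auto
  qed
  ultimately have "card (M - {u}) \<le> card (edges (diametrical_graph M d))"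
    using finite_edges_diametrical_graph[OF assms(1)] by (rule card_inj_on_le)
  then show ?thesis
    using uv by simp
qed

text \<open>If neither end of a diametrical edge were at distance \<open>diam M d\<close> from all
  other points, each end would have a closer companion, giving two forbidden pairs. So there is a
  centre \<open>c\<close>, and an edge avoiding \<open>c\<close> would form an equilateral triangle
  with it.\<close>

lemma card_edges_le_if_stellar:
  assumes "finite M" "card M \<ge> 2" "stellar M d"
  shows "card (edges (diametrical_graph M d)) \<le> card M - 1"
proof -
  obtain u v where uv: "u \<in> M" "v \<in> M" "u \<noteq> v" "d u v = diam M d"
    and le: "\<And>x y. \<lbrakk>x \<in> M; y \<in> M\<rbrakk> \<Longrightarrow> d x y \<le> diam M d"
    using diam_positive assms by metis
  let ?D = "diam M d"
  have tri: "d a b \<noteq> d a c" if "a \<in> M" "b \<in> M" "c \<in> M" "a \<noteq> b" "d a b = d b c" for a b c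
    using assms(3) that by (auto simp: stellar_def)
  have two: "d a c \<le> d c e" if "a \<in> M" "b \<in> M" "c \<in> M" "e \<in> M" "a \<noteq> b" "c \<noteq> e" "d a b < d a c"
    for a b c e
    using assms(3) that by (auto simp: stellar_def)
  have "\<exists>c\<in>M. \<forall>x\<in>M - {c}. d x c = ?D"
  proof (rule ccontr)
    assume "\<not> ?thesis"
    then obtain x y where xy: "x \<in> M" "x \<noteq> u" "d x u \<noteq> ?D" "y \<in> M" "y \<noteq> v" "d y v \<noteq> ?D"
      using uv by blast
    then have "d u x < d u v" "d v y < d u v"
      using le[of x u] le[of y v] uv commute[of x u] commute[of y v] by auto
    then show False
      using two[of u x v y] uv xy by auto
  qed
  then obtain c where c: "c \<in> M" "\<And>x. x \<in> M - {c} \<Longrightarrow> d x c = ?D"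
    by blast
  have "edges (diametrical_graph M d) \<subseteq> (\<lambda>x. {x, c}) ` (M - {c})"
  proof
    fix E
    assume "E \<in> edges (diametrical_graph M d)"
    then obtain x y where E: "E = {x, y}" "x \<in> M" "y \<in> M" "x \<noteq> y" "d x y = ?D"
      by (auto simp: edges_diametrical_graph)
    have "x = c \<or> y = c"
    proof (rule ccontr)
      assume "\<not> ?thesis"
      then have "d x c = ?D" "d y c = ?D"
        using c E by auto
      then show False
        using tri[of x y c] c(1) E by simp
    qed
    then show "E \<in> (\<lambda>x. {x, c}) ` (M - {c})"
      using E by auto
  qed
  then have "card (edges (diametrical_graph M d)) \<le> card ((\<lambda>x. {x, c}) ` (M - {c}))"
    using assms(1) by (intro card_mono) auto
  also have "\<dots> \<le> card (M - {c})"
    using assms(1) by (intro card_image_le) auto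
  finally show ?thesis
    using c assms(1) by simp
qed

text \<open>A triangle has one edge more than a star on three points, so this set violates the bound
  \<open>card Y - 1\<close>.\<close>

lemma card_edges_equilateral:
  assumes "a \<in> M" "b \<in> M" "c \<in> M" "a \<noteq> b" "d a b = d b c" "d a b = d a c"
  shows "card {a, b, c} = 3" "card (edges (diametrical_graph {a, b, c} d)) \<ge> 3"
proof -
  have pos: "d a b > 0"
    using assms mdist_pos_less by blast
  then have ne: "b \<noteq> c" "a \<noteq> c"
    using assms by (metis mdist_zero less_irrefl)+
  then show "card {a, b, c} = 3"
    using assms by simp
  have diam: "diam {a, b, c} d = d a b"
    by (rule diam_eqI[of a _ b]) (use assms pos commute in auto)
  have "{{a, b}, {b, c}, {a, c}} \<subseteq> edges (diametrical_graph {a, b, c} d)"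
    using assms ne diam by (auto intro!: edge_diametrical_graphI)
  then have "card {{a, b}, {b, c}, {a, c}} \<le> card (edges (diametrical_graph {a, b, c} d))"
    by (intro card_mono finite_edges_diametrical_graph) auto
  then show "card (edges (diametrical_graph {a, b, c} d)) \<ge> 3"
    using assms(4) ne by (simp add: doubleton_eq_iff)
qed

text \<open>By the isosceles property the four cross pairs are all diametrical. They form a 4-cycle,
  which has one edge more than a star on four points.\<close>

lemma card_edges_two_pairs:
  assumes "a \<in> M" "b \<in> M" "c \<in> M" "e \<in> M" "a \<noteq> b" "c \<noteq> e" "d a b < d a c" "d c e < d a c"
  shows "card {a, b, c, e} = 4" "card (edges (diametrical_graph {a, b, c, e} d)) \<ge> 4"
proof -
  have eq: "d b c = d a c" "d a e = d a c" "d b e = d a c"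
    using isosceles[of b a c] isosceles[of e c a] isosceles[of e c b] assms commute by metis+
  have pos: "d a c > 0"
    using assms nonneg[of a b] by linarith
  then have ne: "a \<noteq> c" "a \<noteq> e" "b \<noteq> c" "b \<noteq> e"
    using assms eq by auto
  then show "card {a, b, c, e} = 4"
    using assms by simp
  have diam: "diam {a, b, c, e} d = d a c"
    by (rule diam_eqI[of a _ c]) (use assms eq pos commute in \<open>auto simp: less_imp_le\<close>)
  have "{{a, c}, {a, e}, {b, c}, {b, e}} \<subseteq> edges (diametrical_graph {a, b, c, e} d)"
    using assms ne eq diam by (auto intro!: edge_diametrical_graphI)
  then have "card {{a, c}, {a, e}, {b, c}, {b, e}} \<le> card (edges (diametrical_graph {a, b, c, e} d))"
    by (intro card_mono finite_edges_diametrical_graph) auto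
  then show "card (edges (diametrical_graph {a, b, c, e} d)) \<ge> 4"
    using assms(5,6) ne by (simp add: doubleton_eq_iff)
qed

text \<open>\<open>stellar\<close> passes to subsets, so the bound for a whole space applies to each
  \<open>Y\<close>. Conversely, each forbidden configuration is itself a subset violating the
  bound.\<close>

lemma stellar_iff_card_edges_le:
  assumes "finite M"
  shows "stellar M d \<longleftrightarrow>
    (\<forall>Y\<subseteq>M. card Y \<ge> 2 \<longrightarrow> card (edges (diametrical_graph Y d)) \<le> card Y - 1)"
proof
  assume st: "stellar M d"
  show "\<forall>Y\<subseteq>M. card Y \<ge> 2 \<longrightarrow> card (edges (diametrical_graph Y d)) \<le> card Y - 1"
  proof (intro allI impI)
    fix Y
    assume Y: "Y \<subseteq> M" "card Y \<ge> 2"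
    interpret Y: ultrametric_space Y d
      using Y(1) by (rule subspace_ultrametric)
    have "stellar Y d"
      using st Y(1) unfolding stellar_def by (meson subsetD)
    then show "card (edges (diametrical_graph Y d)) \<le> card Y - 1"
      using Y assms finite_subset Y.card_edges_le_if_stellar by blast
  qed
next
  assume R: "\<forall>Y\<subseteq>M. card Y \<ge> 2 \<longrightarrow> card (edges (diametrical_graph Y d)) \<le> card Y - 1"
  show "stellar M d"
    unfolding stellar_def
  proof (intro conjI ballI impI notI)
    fix a b c
    assume abc: "a \<in> M" "b \<in> M" "c \<in> M" "a \<noteq> b" "d a b = d b c" "d a b = d a c"
    then show False
      using R[rule_format, of "{a, b, c}"] card_edges_equilateral[OF abc] by auto
  next
    fix a b c e
    assume abce: "a \<in> M" "b \<in> M" "c \<in> M" "e \<in> M" "a \<noteq> b" "c \<noteq> e" "d a b < d a c"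
    show "d a c \<le> d c e"
    proof (rule ccontr)
      assume "\<not> ?thesis"
      then have "d c e < d a c"
        by simp
      then show False
        using R[rule_format, of "{a, b, c, e}"] card_edges_two_pairs[OF abce] abce by auto
    qed
  qed
qed

section \<open>Twins and isometries that move few points\<close>

lemma twins_swap_Iso:
  assumes "twins M d x y"
  shows "restrict (Transposition.transpose x y) M \<in> Iso M d"
proof -
  have xy: "x \<in> M" "y \<in> M" "x \<noteq> y" "\<And>z. z \<in> M \<Longrightarrow> z \<noteq> x \<Longrightarrow> z \<noteq> y \<Longrightarrow> d x z = d y z"
    using assms by (auto simp: twins_def)
  have "bij_betw (Transposition.transpose x y) M M"
    using xy by (simp add: bij_betw_transpose_iff)
  then have "bij_betw (restrict (Transposition.transpose x y) M) M M"
    by (simp cong: bij_betw_cong)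
  moreover have "d (Transposition.transpose x y p) (Transposition.transpose x y q) = d p q"
    if "p \<in> M" "q \<in> M" for p q
    using xy(1-3) xy(4)[OF that(1)] xy(4)[OF that(2)] that commute mdist_zero
    by (auto simp: Transposition.transpose_def)
  ultimately show ?thesis
    by (simp add: Iso_def)
qed

text \<open>A closest pair of \<open>S\<close> is a pair of twins.\<close>

lemma homogeneous_in_twins:
  assumes "finite M" "homogeneous_in M d S" "a \<in> S" "b \<in> S" "a \<noteq> b"
  obtains x y where "x \<in> S" "y \<in> S" "twins M d x y"
proof -
  have S: "S \<subseteq> M" "\<And>x y z. x \<in> S \<Longrightarrow> y \<in> S \<Longrightarrow> z \<in> M \<Longrightarrow> z \<notin> S \<Longrightarrow> d x z = d y z"
    using assms(2) unfolding homogeneous_in_def by blast+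
  let ?P = "{(x, y) \<in> S \<times> S. x \<noteq> y}"
  have "?P \<subseteq> M \<times> M"
    using S(1) by auto
  then have "finite ?P"
    using assms(1) finite_subset by blast
  moreover have "?P \<noteq> {}"
    using assms by blast
  ultimately obtain p where "is_arg_min (case_prod d) (\<lambda>p. p \<in> ?P) p"
    using ex_is_arg_min_if_finite by blast
  then obtain x y where xy: "x \<in> S" "y \<in> S" "x \<noteq> y"
    and min: "\<And>u v. \<lbrakk>u \<in> S; v \<in> S; u \<noteq> v\<rbrakk> \<Longrightarrow> d x y \<le> d u v"
    by (cases p) (auto simp: is_arg_min_linorder)
  \<comment> \<open>For \<open>z\<close> outside \<open>S\<close> this is homogeneity. For
    \<open>z\<close> in \<open>S\<close>, \<open>d x y\<close> is a shortest side of the triangle,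
    so the other two sides agree.\<close>
  have "d x z = d y z" if z: "z \<in> M" "z \<noteq> x" "z \<noteq> y" for z
  proof (cases "z \<in> S")
    case True
    have "d x y \<le> d x z" "d x y \<le> d y z"
      using min xy True z by auto
    then show ?thesis
      using ultra[of x z y] ultra[of y z x] xy z S(1) commute[of x y] by force
  qed (use S xy z in blast)
  then have "twins M d x y"
    using xy S(1) by (auto simp: twins_def)
  then show thesis
    using that xy by blast
qed

text \<open>Swapping a closest pair moves exactly two points, so the minimum is at most
  \<open>card M - 2\<close>; equality says that no isometry moves more.\<close>

lemma class_R_iff:
  assumes "finite M" "card M \<ge> 2"
  shows "class_R M d \<longleftrightarrow> (\<forall>g\<in>Iso M d. card {x \<in> M. g x \<noteq> x} \<le> 2)"
proof -
  let ?F = "(\<lambda>g. card (Fix M g)) ` Iso M d"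
  obtain a b where "a \<in> M" "b \<in> M" "a \<noteq> b"
    using diam_positive assms by metis
  \<comment> \<open>\<open>M\<close> has no outside points, so it is homogeneous in itself.\<close>
  then obtain x y where xy: "twins M d x y"
    using homogeneous_in_twins[of M a b] assms(1) unfolding homogeneous_in_def by blast
  let ?s = "restrict (Transposition.transpose x y) M"
  have s: "?s \<in> Iso M d"
    using xy by (rule twins_swap_Iso)
  have "{z \<in> M. ?s z \<noteq> z} = {x, y}"
    using xy by (auto simp: twins_def Transposition.transpose_def)
  then have "card (Fix M ?s) + 2 = card M"
    using card_Fix[OF assms(1), of ?s] xy by (simp add: twins_def)
  then have s': "card M - 2 \<in> ?F"
    using s by (intro image_eqI[of _ _ ?s]) auto
  have F: "finite ?F"
    using finite_Iso assms(1) by blast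
  \<comment> \<open>Integer and truncated subtraction agree because
    \<open>card M \<ge> 2\<close>.\<close>
  have "class_R M d \<longleftrightarrow> Min ?F = card M - 2"
    using assms ultrametric_space_axioms by (auto simp: class_R_def)
  also have "\<dots> \<longleftrightarrow> (\<forall>g\<in>Iso M d. card M - 2 \<le> card (Fix M g))"
    using Min_eq_iff[OF F, of "card M - 2"] s' by auto
  also have "\<dots> \<longleftrightarrow> (\<forall>g\<in>Iso M d. card {x \<in> M. g x \<noteq> x} \<le> 2)"
  proof (rule ball_cong)
    fix g
    show "card M - 2 \<le> card (Fix M g) \<longleftrightarrow> card {x \<in> M. g x \<noteq> x} \<le> 2"
      using card_Fix[OF assms(1), of g] assms(2) by linarith
  qed simp
  finally show ?thesis .
qed

text \<open>The composition of two different swaps moves every point of both pairs: it is a 3-cycle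
  if they share a point, and a double transposition otherwise.\<close>

lemma twins_unique:
  assumes "finite M" "\<And>g. g \<in> Iso M d \<Longrightarrow> card {x \<in> M. g x \<noteq> x} \<le> 2"
    and xy: "twins M d x y" and uv: "twins M d u v"
  shows "{x, y} = {u, v}"
proof (rule ccontr)
  assume ne: "{x, y} \<noteq> {u, v}"
  let ?g = "compose M (restrict (Transposition.transpose x y) M)
    (restrict (Transposition.transpose u v) M)"
  have in_M: "x \<in> M" "y \<in> M" "u \<in> M" "v \<in> M" "x \<noteq> y" "u \<noteq> v"
    using xy uv by (auto simp: twins_def)
  have "?g z = Transposition.transpose x y (Transposition.transpose u v z)" if "z \<in> M" for z
    using that in_M by (auto simp: compose_eq Transposition.transpose_def)
  then have "{x, y, u, v} \<subseteq> {z \<in> M. ?g z \<noteq> z}"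
    using in_M ne by (auto simp: Transposition.transpose_def split: if_splits)
  then have "card {x, y, u, v} \<le> card {z \<in> M. ?g z \<noteq> z}"
    using assms(1) by (intro card_mono) auto
  also have "\<dots> \<le> 2"
    using assms(2) compose_Iso twins_swap_Iso xy uv by blast
  finally show False
    using in_M ne by (auto simp: card_insert_if split: if_splits)
qed

text \<open>A point \<open>z\<close> outside is farther from the centre than any \<open>x\<close>
  inside, so the isosceles property gives \<open>d x z = d a z\<close>.\<close>

lemma homogeneous_in_open_ball:
  assumes "a \<in> M"
  shows "homogeneous_in M d {x \<in> M. d x a < r}"
  unfolding homogeneous_in_def
proof (intro conjI ballI)
  fix x y z
  assume *: "x \<in> {x \<in> M. d x a < r}" "y \<in> {x \<in> M. d x a < r}" "z \<in> M - {x \<in> M. d x a < r}"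
  then have "d x a < d a z" "d y a < d a z"
    using commute[of a z] by auto
  then show "d x z = d y z"
    using isosceles[of x a z] isosceles[of y a z] * assms by auto
qed auto

text \<open>A point outside both balls is at least \<open>d a b\<close> away from both centres,
  hence equidistant from them; the isosceles property extends this to the points of the
  balls.\<close>

lemma homogeneous_in_two_open_balls:
  assumes "a \<in> M" "b \<in> M"
  shows "homogeneous_in M d ({x \<in> M. d x a < d a b} \<union> {x \<in> M. d x b < d a b})"
    (is "homogeneous_in M d ?S")
  unfolding homogeneous_in_def
proof (intro conjI ballI)
  fix x y z
  assume *: "x \<in> ?S" "y \<in> ?S" "z \<in> M - ?S"
  then have z: "d a b \<le> d z a" "d a b \<le> d z b" "z \<in> M"
    by auto
  then have ab: "d a z = d b z"
    using ultra[of a z b] ultra[of b z a] commute[of a z] commute[of b z] commute[of a b] assms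
    by auto
  have "d p z = d a z" if "p \<in> ?S" for p
    using isosceles[of p a z] isosceles[of p b z] that z ab assms commute[of a z] commute[of b z]
    by auto
  then show "d x z = d y z"
    using * by simp
qed auto

text \<open>Each forbidden configuration yields homogeneous sets with at least two points and no
  point common to all of them. Each set contains twins, contradicting
  \<open>twins_unique\<close>.\<close>

lemma stellar_if_few_moved:
  assumes "finite M" "\<And>g. g \<in> Iso M d \<Longrightarrow> card {x \<in> M. g x \<noteq> x} \<le> 2"
  shows "stellar M d"
  unfolding stellar_def
proof (intro conjI ballI impI notI)
  fix a b c
  assume abc: "a \<in> M" "b \<in> M" "c \<in> M" "a \<noteq> b" "d a b = d b c" "d a b = d a c"
  define r where "r = d a b"
  define B where "B p = {x \<in> M. d x p < r}" for p
  have r: "d a b = r" "d b c = r" "d a c = r" "r > 0" "b \<noteq> c" "a \<noteq> c"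
    using abc by (auto simp: r_def)
  \<comment> \<open>A single ball may be just its centre, so twins are sought in the union of
    two.\<close>
  have "\<exists>x y. twins M d x y \<and> {x, y} \<subseteq> B p \<union> B q"
    if pq: "p \<in> M" "q \<in> M" "p \<noteq> q" "d p q = r" for p q
  proof -
    have "homogeneous_in M d (B p \<union> B q)"
      unfolding B_def using homogeneous_in_two_open_balls[of p q] pq by simp
    moreover have "p \<in> B p \<union> B q" "q \<in> B p \<union> B q"
      using pq r by (auto simp: B_def)
    ultimately show ?thesis
      using homogeneous_in_twins[OF assms(1)] pq(3) by (metis empty_subsetI insert_subset)
  qed
  then obtain x y x' y' x'' y'' where
    "twins M d x y" "{x, y} \<subseteq> B a \<union> B b"
    "twins M d x' y'" "{x', y'} \<subseteq> B b \<union> B c"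
    "twins M d x'' y''" "{x'', y''} \<subseteq> B a \<union> B c"
    using abc r by metis
  \<comment> \<open>All three pairs coincide, so \<open>x\<close> lies in all three unions and hence
    in two of the balls; but the balls are pairwise disjoint.\<close>
  then have x: "x \<in> B a \<union> B b" "x \<in> B b \<union> B c" "x \<in> B a \<union> B c"
    using twins_unique[OF assms, of x y x' y'] twins_unique[OF assms, of x y x'' y''] by auto
  have "B p \<inter> B q = {}" if "p \<in> M" "q \<in> M" "d p q = r" for p q
    using ultra[of p q] that commute by (force simp: B_def)
  then show False
    using x abc r by blast
next
  fix a b c e
  assume *: "a \<in> M" "b \<in> M" "c \<in> M" "e \<in> M" "a \<noteq> b" "c \<noteq> e" "d a b < d a c"
  define B where "B p = {x \<in> M. d x p < d a c}" for p
  show "d a c \<le> d c e"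
  proof (rule ccontr)
    assume "\<not> ?thesis"
    then have ce: "d c e < d a c"
      by simp
    have pos: "d a c > 0"
      using * nonneg[of a b] by linarith
    have in_B: "a \<in> B a" "b \<in> B a" "c \<in> B c" "e \<in> B c"
      using * ce pos commute by (auto simp: B_def)
    have "homogeneous_in M d (B a)" "homogeneous_in M d (B c)"
      unfolding B_def using * by (auto intro: homogeneous_in_open_ball)
    then obtain x y u v where "x \<in> B a" "twins M d x y" "u \<in> B c" "v \<in> B c" "twins M d u v"
      using homogeneous_in_twins[OF assms(1)] in_B *(5,6) by metis
    then have "x \<in> B a \<inter> B c"
      using twins_unique[OF assms, of x y u v] by auto
    then show False
      using ultra[of a c x] * commute by (force simp: B_def)
  qed
qed

section \<open>Isometries of stellar spaces\<close>

text \<open>Such an isometry is an involution, and two distinct orbits of moved points would contain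
  a forbidden configuration.\<close>

lemma few_moved_if_stellar:
  assumes "finite M" "stellar M d" "g \<in> Iso M d"
  shows "card {x \<in> M. g x \<noteq> x} \<le> 2"
proof -
  have tri: "d a b \<noteq> d a c" if "a \<in> M" "b \<in> M" "c \<in> M" "a \<noteq> b" "d a b = d b c" for a b c
    using assms(2) that by (auto simp: stellar_def)
  have two: "d a c \<le> d c e" if "a \<in> M" "b \<in> M" "c \<in> M" "e \<in> M" "a \<noteq> b" "c \<noteq> e" "d a b < d a c"
    for a b c e
    using assms(2) that by (auto simp: stellar_def)
  have gM: "g x \<in> M" if "x \<in> M" for x
    using assms(3) that by (auto simp: Iso_def bij_betw_def)
  have dg: "d (g x) (g y) = d x y" if "x \<in> M" "y \<in> M" for x y
    using assms(3) that by (auto simp: Iso_def)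
  have inj: "g x = g y \<longleftrightarrow> x = y" if "x \<in> M" "y \<in> M" for x y
    using assms(3) that by (auto simp: Iso_def bij_betw_def inj_on_eq_iff)
  \<comment> \<open>Otherwise the equal sides \<open>d x (g x)\<close> and
    \<open>d (g x) (g (g x))\<close> force \<open>d x (g (g x))\<close> to be smaller. Then
    \<open>{x, g (g x)}\<close> and its image under \<open>g\<close> are two forbidden
    pairs.\<close>
  have gg: "g (g x) = x" if x: "x \<in> M" for x
  proof (rule ccontr)
    assume n: "g (g x) \<noteq> x"
    then have n': "g x \<noteq> x"
      by auto
    have "d (g x) (g (g x)) = d x (g x)"
      using dg x gM by blast
    then have "d x (g (g x)) < d x (g x)"
      using tri[of x "g x" "g (g x)"] ultra[of x "g (g x)" "g x"] x gM n' by auto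
    moreover have "d (g x) (g (g (g x))) = d x (g (g x))"
      using dg x gM by blast
    moreover have "g x \<noteq> g (g (g x))"
      using inj[of x "g (g x)"] x gM n by auto
    ultimately show False
      using two[of x "g (g x)" "g x" "g (g (g x))"] x gM n by auto
  qed
  have main: False
    if xy: "x \<in> M" "y \<in> M" "g x \<noteq> x" "g y \<noteq> y" "y \<noteq> x" "y \<noteq> g x"
      and le: "d y (g y) \<le> d x (g x)" for x y
  proof -
    \<comment> \<open>As \<open>g\<close> is an involution, the four distances between the orbits of
      \<open>x\<close> and \<open>y\<close> take only these two values.\<close>
    have t: "d (g x) (g y) = d x y" "d (g x) y = d x (g y)"
      using dg[of x y] dg[of x "g y"] gM gg xy by auto
    have n: "g y \<noteq> x" "g y \<noteq> g x"
      using gg xy by (auto simp: inj)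
    \<comment> \<open>Otherwise the orbits \<open>{x, g x}\<close> and \<open>{y, g y}\<close> are
      themselves the two forbidden pairs.\<close>
    have "d x y \<le> d x (g x)"
    proof (rule ccontr)
      assume "\<not> ?thesis"
      then show False
        using two[of x "g x" y "g y"] xy gM le by auto
    qed
    moreover have "d x (g y) \<le> d x (g x)"
      using calculation ultra[of x "g y" y] xy gM le by auto
    moreover have "d x (g x) \<le> max (d x y) (d x (g y))"
      using ultra[of x "g x" y] t commute[of "g x" y] xy gM by auto
    \<comment> \<open>By the bounds above, one of the two cross distances equals
      \<open>d x (g x)\<close>. The other must be smaller, since \<open>x\<close>,
      \<open>g x\<close>, \<open>y\<close> are not equilateral; here this makes
      \<open>{x, g y}\<close> and \<open>{y, g x}\<close> two forbidden pairs. The remaining case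
      exchanges \<open>y\<close> and \<open>g y\<close>.\<close>
    moreover have False if "d x y = d x (g x)" "d x (g y) \<le> d x (g x)"
    proof -
      have "d x (g y) \<noteq> d x (g x)"
        using tri[of x "g x" y] that t xy gM by auto
      then show False
        using two[of x "g y" y "g x"] that xy gM n t commute[of "g x" y] by auto
    qed
    moreover have False if "d x (g y) = d x (g x)" "d x y \<le> d x (g x)"
    proof -
      have "d x y \<noteq> d x (g x)"
        using tri[of x "g x" y] that t xy gM by auto
      then show False
        using two[of x y "g y" "g x"] that xy gM n t commute[of "g y" "g x"] by auto
    qed
    ultimately show False
      by linarith
  qed
  \<comment> \<open>The roles of \<open>x\<close> and \<open>y\<close> may be exchanged, because
    \<open>x = g y\<close> and \<open>y = g x\<close> are equivalent for an involution.\<close>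
  have pair: "y = x \<or> y = g x" if "x \<in> M" "y \<in> M" "g x \<noteq> x" "g y \<noteq> y" for x y
  proof (cases "d y (g y) \<le> d x (g x)")
    case True
    then show ?thesis
      using main[of x y] that by blast
  next
    case False
    then show ?thesis
      using main[of y x] that gg by force
  qed
  show ?thesis
  proof (cases "{x \<in> M. g x \<noteq> x} = {}")
    case True
    show ?thesis
      unfolding True by simp
  next
    case False
    then obtain x where "x \<in> M" "g x \<noteq> x"
      by blast
    then have "{x \<in> M. g x \<noteq> x} \<subseteq> {x, g x}"
      using pair by blast
    then have "card {x \<in> M. g x \<noteq> x} \<le> card {x, g x}"
      by (intro card_mono) auto
    also have "\<dots> \<le> 2"
      by (simp add: card_insert_if)
    finally show ?thesis .
  qed
qed

lemma class_R_iff_stellar: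
  assumes "finite M" "card M \<ge> 2"
  shows "class_R M d \<longleftrightarrow> stellar M d"
  unfolding class_R_iff[OF assms]
  using stellar_if_few_moved few_moved_if_stellar assms(1) by blast

end

section \<open>Sharpness of the bound and the equivalence\<close>

lemma ex_star_diametrical_graph:
  assumes "n \<ge> 2"
  obtains Z :: "'b::infinite set" and \<rho> where "ultrametric_space Z \<rho>" "card Z = n"
    "card (edges (diametrical_graph Z \<rho>)) \<le> n - 1"
proof -
  obtain Z :: "'b set" where Z: "finite Z" "card Z = n"
    using infinite_arbitrarily_large[OF infinite_UNIV] by blast
  obtain c e where c: "c \<in> Z" "e \<in> Z" "c \<noteq> e"
    using card_le_Suc0_iff_eq[OF Z(1)] Z(2) assms by (metis not_less_eq_eq numeral_2_eq_2)
  \<comment> \<open>The point \<open>c\<close> is at distance 2 from all others, which are at mutual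
    distance 1. Thus every diametrical edge contains \<open>c\<close>.\<close>
  define \<rho> :: "'b \<Rightarrow> 'b \<Rightarrow> real"
    where "\<rho> x y = (if x = y then 0 else if x = c \<or> y = c then 2 else 1)" for x y
  have "ultrametric_space Z \<rho>"
    by unfold_locales (auto simp: \<rho>_def)
  moreover have "diam Z \<rho> = 2"
    by (rule diam_eqI[of c _ e]) (use c in \<open>auto simp: \<rho>_def\<close>)
  then have "edges (diametrical_graph Z \<rho>) \<subseteq> (\<lambda>x. {x, c}) ` (Z - {c})"
    unfolding edges_diametrical_graph by (auto simp: \<rho>_def split: if_splits)
  then have "card (edges (diametrical_graph Z \<rho>)) \<le> card ((\<lambda>x. {x, c}) ` (Z - {c}))"
    using Z by (intro card_mono) auto
  then have "card (edges (diametrical_graph Z \<rho>)) \<le> card (Z - {c})"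
    using card_image_le[of "Z - {c}" "\<lambda>x. {x, c}"] Z(1) by simp
  then have "card (edges (diametrical_graph Z \<rho>)) \<le> n - 1"
    using Z c by simp
  ultimately show thesis
    using that Z by blast
qed

theorem proposition4p6:
  fixes X :: "'a set" and d :: "'a \<Rightarrow> 'a \<Rightarrow> real"
  assumes "ultrametric_space X d" and "finite X" and "card X \<ge> 2"
  shows "class_R X d \<longleftrightarrow>
    (\<forall>Y (Z :: 'b::infinite set) \<rho>.
       Y \<subseteq> X \<longrightarrow> ultrametric_space Z \<rho> \<longrightarrow> card Y = card Z \<longrightarrow> card Z \<ge> 2 \<longrightarrow>
       card (edges (diametrical_graph Y d)) \<le> card (edges (diametrical_graph Z \<rho>)))"
    (is "_ \<longleftrightarrow> ?minimal")
proof -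
  interpret ultrametric_space X d
    by fact
  \<comment> \<open>Since \<open>card Y - 1\<close> is the least number of edges over all
    ultrametric spaces with \<open>card Y\<close> points, comparison with every \<open>Z\<close>
    reduces to this bound.\<close>
  have "class_R X d \<longleftrightarrow>
    (\<forall>Y\<subseteq>X. card Y \<ge> 2 \<longrightarrow> card (edges (diametrical_graph Y d)) \<le> card Y - 1)" (is "_ \<longleftrightarrow> ?stars")
    using class_R_iff_stellar stellar_iff_card_edges_le assms by simp
  also have "?stars \<longleftrightarrow> ?minimal"
  proof
    assume stars: ?stars
    show ?minimal
    proof (intro allI impI)
      fix Y and Z :: "'b set" and \<rho>
      assume Y: "Y \<subseteq> X" and Z: "ultrametric_space Z \<rho>" "card Y = card Z" "card Z \<ge> 2"
      \<comment> \<open>An infinite set has \<open>card\<close> equal to 0.\<close>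
      have "finite Z"
        using Z(3) by (metis card.infinite not_numeral_le_zero)
      then have "card Z - 1 \<le> card (edges (diametrical_graph Z \<rho>))"
        using ultrametric_space.card_edges_ge Z by blast
      then show "card (edges (diametrical_graph Y d)) \<le> card (edges (diametrical_graph Z \<rho>))"
        using stars Y Z by (metis order_trans)
    qed
  next
    assume minimal: ?minimal
    show ?stars
    proof (intro allI impI)
      fix Y
      assume Y: "Y \<subseteq> X" "card Y \<ge> 2"
      obtain Z :: "'b set" and \<rho> where "ultrametric_space Z \<rho>" "card Z = card Y"
        "card (edges (diametrical_graph Z \<rho>)) \<le> card Y - 1"
        using ex_star_diametrical_graph Y(2) by blast
      then show "card (edges (diametrical_graph Y d)) \<le> card Y - 1"
        using minimal Y by (metis order_trans)
    qed
  qed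
  finally show ?thesis .
qed

end
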